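(* Let $k\ge 3$ and $n$ be integers. If $$n\ge\frac{\log_2\bigl(1+\sqrt{21}\,\bigr)}{3}(13k-19),$$ then the multiplicative inverse function $f_{\mathrm{inv}}$ on $\mathbb F_{2^n}$ is not $k$th order sum-free. Moreover, the displayed condition is satisfied when $n\ge 10.8k-15.7$.
   Context: The multiplicative inverse function $f_{\mathrm{inv}}:\mathbb F_{2^n}\to\mathbb F_{2^n}$ is defined by $f_{\mathrm{inv}}(x)=x^{-1}$ for $x\ne 0$ and $f_{\mathrm{inv}}(0)=0$. A function $f:\mathbb F_{2^n}\to\mathbb F_{2^n}$ is $k$th order sum-free if $\sum_{x\in A}f(x)\ne 0$ for every $k$-dimensional $\mathbb F_2$-affine subspace $A$ of $\mathbb F_{2^n}$. *)

theory Defs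
  imports Complex_Main "HOL-Library.Z2" "HOL-Library.Cardinality" "HOL-Number_Theory.Residues"
begin

definition f_inv :: "'a::field \<Rightarrow> 'a" where
  "f_inv x = (if x = 0 then 0 else inverse x)"

(* Scalar multiplication by the prime field F_2, which is the type bit of HOL-Library.Z2.
   This is a vector space structure exactly when the field has characteristic 2; see
   vector_space_F2_scale for the fields with 2^n elements. *)
definition F2_scale :: "bit \<Rightarrow> 'a::field \<Rightarrow> 'a" where
  "F2_scale c x = (if c = 1 then x else 0)"

lemma vector_space_F2_scale:
  assumes "CARD('a::{field,finite}) = 2 ^ n"
  shows "vector_space (F2_scale :: bit \<Rightarrow> 'a \<Rightarrow> 'a)"
proof -
  have "CHAR('a) dvd 2 ^ n"
    using CHAR_dvd_CARD[where ?'a = 'a] assms by simp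
  moreover have "prime CHAR('a)"
    by (rule prime_CHAR_semidom) (simp add: finite_imp_CHAR_pos)
  ultimately have "CHAR('a) = 2"
    by (metis prime_dvd_power primes_dvd_imp_eq two_is_prime_nat)
  then have "of_nat 2 = (0 :: 'a)"
    by (metis of_nat_CHAR)
  then have "x + x = 0" for x :: 'a
    by (metis mult_2 mult_zero_left of_nat_numeral)
  then show ?thesis
    by unfold_locales (auto simp: F2_scale_def elim: bit.exhaust)
qed

definition F2_affine_subspace :: "nat \<Rightarrow> 'a::field set \<Rightarrow> bool" where
  "F2_affine_subspace k A \<longleftrightarrow>
     (\<exists>a S. module.subspace F2_scale S \<and> vector_space.dim F2_scale S = k \<and> A = (\<lambda>x. a + x) ` S)"

definition sum_free_of_order :: "nat \<Rightarrow> ('a::{field,finite} \<Rightarrow> 'a) \<Rightarrow> bool" where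
  "sum_free_of_order k f \<longleftrightarrow> (\<forall>A. F2_affine_subspace k A \<longrightarrow> (\<Sum>x\<in>A. f x) \<noteq> 0)"

end

theory Submission
  imports Defs "HOL-Library.Product_Plus" "HOL-Computational_Algebra.Polynomial"
begin

text \<open>
  The proof constructs a linear subspace $E$ of dimension $k$ on which the inverses of the nonzero
  elements sum to 0. Write $S(E)$ for this sum and $q = 2^n$.

  If $L$ is an additive polynomial with kernel $W$ and linear coefficient $c$, and if the range of $L$
  contains a subspace $F$, then the logarithmic derivative of $L$ gives
  $S(L^{-1}(F)) = S(W) + c\,S(F)$ (\<open>inv_sum_vimage\<close>). Start with $F$ of dimension $m = k - 2$ and
  $S(F) = 1$, which is obtained by adding one dimension at a time (\<open>subgroup_inv_sum_1\<close>). A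
  two-dimensional kernel $W$ then makes the right-hand side vanish precisely when suitable coordinates
  $(p, r)$ of $W$ satisfy $p^2 + pr + r^2 = 1$. The condition that $F$ lies in the range of $L$ becomes
  $p, r \in K$ for a subspace $K$ of codimension $m$ that depends only on $F$ (\<open>preimage_quartic\<close>).

  So the problem is to find points of a conic in $K \times K$ other than the three degenerate ones.
  Expanding in characters, this follows once the nontrivial character sums over the conic are small
  compared with $q/4^m$. Here the conic is special: it is the group of elements of norm 1 of a
  quadratic algebra, and its action makes each nontrivial sum occur about $q$ times; moreover, four
  points of the conic sum to 0 only if they cancel in pairs. Comparing these facts in the fourth moment
  bounds each sum by a constant times $q^{3/4}$ (\<open>conic_sum_bound\<close>). That suffices as soon as
  $n \geq 8m + 6 = 8k - 10$, which the logarithmic condition implies.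
\<close>

section \<open>Finite fields of characteristic two and the trace character\<close>

locale binary_field =
  fixes n :: nat and type :: "'a::{field,finite} itself"
  assumes card_UNIV: "CARD('a) = 2 ^ n"
begin

lemma add_self [simp]: "x + x = (0::'a)"
proof -
  interpret vector_space "F2_scale :: bit \<Rightarrow> 'a \<Rightarrow> 'a"
    by (rule vector_space_F2_scale) (rule card_UNIV)
  have "F2_scale (1 + 1) x = F2_scale 1 x + F2_scale 1 x"
    by (rule scale_left_distrib)
  then show ?thesis
    by (simp add: F2_scale_def)
qed

lemma add_self_left [simp]: "x + (x + y) = (y::'a)"
  by (simp flip: add.assoc)

lemma minus_eq [simp]: "- x = (x::'a)"
  by (metis add_self add.inverse_unique)

lemma diff_eq [simp]: "x - y = x + (y::'a)"
  by (metis minus_eq diff_conv_add_uminus)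

lemma add_eq_0 [simp]: "x + y = 0 \<longleftrightarrow> x = (y::'a)"
  by (metis add_self add_eq_0_iff minus_eq)

lemma numeral_Bit0_eq [simp]: "numeral (num.Bit0 w) = (0::'a)"
  by (simp add: numeral_Bit0)

lemma numeral_Bit1_eq [simp]: "numeral (num.Bit1 w) = (1::'a)"
  by (simp add: numeral_Bit1)

lemma square_add: "(x + y)\<^sup>2 = x\<^sup>2 + (y::'a)\<^sup>2"
  by (simp add: power2_eq_square algebra_simps)

lemma square_eq_iff [simp]: "x\<^sup>2 = (y::'a)\<^sup>2 \<longleftrightarrow> x = y"
  by (metis add_eq_0 square_add zero_eq_power2)

lemma bij_square: "bij (\<lambda>x::'a. x\<^sup>2)"
  by (simp add: bij_def inj_def finite_UNIV_inj_surj)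

lemma square_root: obtains y where "y\<^sup>2 = (x::'a)"
  by (metis bij_square bij_pointE)

lemma power_card: "x ^ 2 ^ n = (x::'a)"
proof (cases "x = 0")
  case False
  have "(\<Prod>y\<in>-{0}. x * y) = (\<Prod>y\<in>-{0::'a}. y)"
    by (rule prod.reindex_bij_witness[of _ "\<lambda>y. y / x" "\<lambda>y. x * y"]) (use False in auto)
  then have "x ^ card (-{0::'a}) = 1"
    by (simp add: prod.distrib)
  moreover have "2 ^ n = Suc (card (-{0::'a}))"
    using card.remove[of UNIV "0::'a"] by (simp add: card_UNIV Compl_eq_Diff_UNIV)
  ultimately show ?thesis
    by simp
qed simp

lemma n_pos: "n > 0"
proof (rule ccontr)
  assume "\<not> ?thesis"
  then have "card {0, 1::'a} \<le> 1"
    using card_UNIV card_mono[of UNIV "{0, 1::'a}"] by simp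
  then show False
    by simp
qed

definition Tr :: "'a \<Rightarrow> 'a" where
  "Tr x = (\<Sum>i<n. x ^ 2 ^ i)"

lemma Tr_add: "Tr (x + y) = Tr x + Tr y"
proof -
  have "(x + y) ^ 2 ^ i = x ^ 2 ^ i + y ^ 2 ^ i" for i
    by (induction i) (simp_all add: power_mult square_add mult.commute[of 2])
  then show ?thesis
    by (simp add: Tr_def sum.distrib)
qed

lemma Tr_0 [simp]: "Tr 0 = 0"
  using Tr_add[of 0 0] by simp

lemma Tr_square [simp]: "Tr (x\<^sup>2) = Tr x"
proof -
  have "Tr (x\<^sup>2) + x = (\<Sum>i<n. x ^ 2 ^ Suc i) + x"
    by (simp add: Tr_def flip: power_mult)
  also have "\<dots> = (\<Sum>i<Suc n. x ^ 2 ^ i)"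
    by (subst sum.lessThan_Suc_shift) simp
  also have "\<dots> = Tr x + x"
    by (simp add: Tr_def power_card)
  finally show ?thesis
    by simp
qed

lemma Tr_cases: "Tr x = 0 \<or> Tr x = 1"
proof -
  have "(\<Sum>i\<in>I. f i)\<^sup>2 = (\<Sum>i\<in>I. (f i)\<^sup>2)" if "finite I" for I :: "nat set" and f :: "nat \<Rightarrow> 'a"
    using that by induction (simp_all add: square_add)
  from this[of "{..<n}" "\<lambda>i. x ^ 2 ^ i"] have "(Tr x)\<^sup>2 = Tr (x\<^sup>2)"
    by (simp add: Tr_def power_mult[symmetric] mult.commute)
  then have "Tr x * (Tr x - 1) = 0"
    by (simp add: power2_eq_square[of "Tr x"] algebra_simps)
  then show ?thesis
    by auto
qed

text \<open>
  The trace is a polynomial function of degree $2^{n-1}$, fewer than the number of elements of the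
  field, so it cannot vanish everywhere. Every orthogonality relation below rests on this.
\<close>

lemma Tr_nonzero: obtains x where "Tr x \<noteq> 0"
proof (rule ccontr)
  assume "\<not> thesis"
  then have all: "Tr x = 0" for x
    using that by blast
  define p :: "'a poly" where "p = (\<Sum>i<n. monom 1 (2 ^ i))"
  have coeff_1: "coeff p 1 = 1"
  proof -
    have "coeff p 1 = (\<Sum>i<n. if i = 0 then 1 else 0)"
      unfolding p_def coeff_sum by (intro sum.cong) auto
    then show ?thesis
      using n_pos by simp
  qed
  then have "p \<noteq> 0"
    by auto
  moreover have "poly p x = 0" for x
    using all[of x] by (simp add: p_def poly_sum poly_monom Tr_def)
  ultimately have "CARD('a) \<le> degree p"
    using card_poly_roots_bound[of p] by simp
  moreover have "degree p \<le> 2 ^ (n - 1)"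
    unfolding p_def by (intro degree_sum_le) (auto simp: degree_monom_eq)
  moreover have "(2::nat) ^ (n - 1) < 2 ^ n"
    using n_pos by simp
  ultimately show False
    by (simp add: card_UNIV)
qed

definition chi :: "'a \<Rightarrow> real" where
  "chi x = (if Tr x = 0 then 1 else -1)"

lemma chi_add: "chi (x + y) = chi x * chi y"
  using Tr_cases[of x] Tr_cases[of y] by (auto simp: chi_def Tr_add)

lemma chi_0 [simp]: "chi 0 = 1"
  by (simp add: chi_def)

text \<open>
  Multiplication by the scalars 0 and 1 is automatic, so a linear subspace over the field with two
  elements is the same as an additive subgroup.
\<close>

definition add_subgroup :: "'a set \<Rightarrow> bool" where
  "add_subgroup H \<longleftrightarrow> 0 \<in> H \<and> (\<forall>x\<in>H. \<forall>y\<in>H. x + y \<in> H)"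

definition ann :: "'a set \<Rightarrow> 'a set" where
  "ann H = {c. \<forall>h\<in>H. Tr (c * h) = 0}"

lemma add_subgroup_ann: "add_subgroup (ann H)"
  by (auto simp: add_subgroup_def ann_def distrib_right Tr_add)

lemma add_subgroup_add_iff:
  assumes "add_subgroup H" "x \<in> H"
  shows "x + y \<in> H \<longleftrightarrow> y \<in> H"
  using assms unfolding add_subgroup_def by (metis add_self_left)

lemma sum_translate:
  assumes "add_subgroup H" "z \<in> H"
  shows "(\<Sum>x\<in>H. f (z + x)) = (\<Sum>x\<in>H. f x)"
  by (rule sum.reindex_bij_witness[of _ "\<lambda>x. z + x" "\<lambda>x. z + x"])
    (auto simp: add_subgroup_add_iff assms)

text \<open>
  If some element of the subgroup has character value $-1$, translation by it changes the sign of the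
  sum.
\<close>

lemma sum_chi:
  assumes "add_subgroup H"
  shows "(\<Sum>h\<in>H. chi (c * h)) = (if c \<in> ann H then real (card H) else 0)"
proof (cases "c \<in> ann H")
  case True
  then show ?thesis
    by (simp add: ann_def chi_def)
next
  case False
  then obtain z where z: "z \<in> H" "Tr (c * z) \<noteq> 0"
    by (auto simp: ann_def)
  have "(\<Sum>h\<in>H. chi (c * h)) = (\<Sum>h\<in>H. chi (c * (z + h)))"
    using sum_translate[OF assms z(1), of "\<lambda>h. chi (c * h)"] by simp
  also have "\<dots> = (\<Sum>h\<in>H. - chi (c * h))"
    using z(2) by (simp add: distrib_left chi_add) (simp add: chi_def)
  also have "\<dots> = - (\<Sum>h\<in>H. chi (c * h))"
    by (rule sum_negf)
  finally show ?thesis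
    using False by simp
qed

lemma ann_UNIV: "ann UNIV = {0}"
proof -
  obtain z where "Tr z \<noteq> 0"
    by (rule Tr_nonzero)
  have "c = 0" if "c \<in> ann UNIV" for c
  proof (rule ccontr)
    assume "c \<noteq> 0"
    moreover have "Tr (c * (z / c)) = 0"
      using that unfolding ann_def by blast
    ultimately show False
      using \<open>Tr z \<noteq> 0\<close> by simp
  qed
  then show ?thesis
    by (auto simp: ann_def)
qed

lemma sum_chi_UNIV: "(\<Sum>x\<in>UNIV. chi (c * x)) = (if c = 0 then real CARD('a) else 0)"
  using sum_chi[of UNIV c] by (simp add: ann_UNIV add_subgroup_def)

text \<open>
  Both sides evaluate the double sum of the character over the subgroup and the whole field, in the two
  possible orders of summation.
\<close>

lemma card_ann:
  assumes "add_subgroup H"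
  shows "card H * card (ann H) = CARD('a)"
proof -
  have "real (card H * card (ann H)) = (\<Sum>c\<in>UNIV. \<Sum>h\<in>H. chi (c * h))"
    by (simp add: sum_chi[OF assms] sum.If_cases mult.commute)
  also have "\<dots> = (\<Sum>h\<in>H. \<Sum>c\<in>UNIV. chi (h * c))"
    by (subst sum.swap) (simp add: mult.commute)
  also have "\<dots> = real CARD('a)"
    using assms by (simp add: sum_chi_UNIV add_subgroup_def)
  finally show ?thesis
    by linarith
qed

lemma ann_ann:
  assumes "add_subgroup H"
  shows "ann (ann H) = H"
proof -
  have "H \<subseteq> ann (ann H)"
    by (auto simp: ann_def mult.commute)
  moreover have "card (ann (ann H)) = card H"
    using card_ann[OF assms] card_ann[OF add_subgroup_ann, of H] zero_less_card_finite[where 'a='a]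
    by (metis mult.commute mult_cancel2 less_numeral_extra(3) mult_0)
  ultimately show ?thesis
    by (metis card_subset_eq finite)
qed

section \<open>Inverse sums of preimages under additive maps\<close>

definition inv_sum :: "'a set \<Rightarrow> 'a" where
  "inv_sum F = (\<Sum>x\<in>F. inverse x)"

lemma sum_vimage:
  fixes h :: "'a \<Rightarrow> 'b::comm_monoid_add"
  assumes add: "\<And>x y. L (x + y) = L x + L y" and F: "F \<subseteq> range L"
    and g: "\<And>f. f \<in> F \<Longrightarrow> L (g f) = (f :: 'a)"
  shows "(\<Sum>x\<in>L -` F. h x) = (\<Sum>f\<in>F. \<Sum>w\<in>{w. L w = 0}. h (g f + w))"
proof -
  have "(\<Sum>x\<in>L -` F. h x) = (\<Sum>f\<in>F. \<Sum>x\<in>{x \<in> L -` F. L x = f}. h x)"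
    by (rule sum.group[symmetric]) auto
  also have "\<dots> = (\<Sum>f\<in>F. \<Sum>w\<in>{w. L w = 0}. h (g f + w))"
  proof (rule sum.cong[OF refl])
    fix f assume "f \<in> F"
    then show "(\<Sum>x\<in>{x \<in> L -` F. L x = f}. h x) = (\<Sum>w\<in>{w. L w = 0}. h (g f + w))"
      by (intro sum.reindex_bij_witness[of _ "\<lambda>w. g f + w" "\<lambda>x. g f + x"])
        (auto simp: add g)
  qed
  finally show ?thesis .
qed

lemma card_vimage_additive:
  fixes L :: "'a \<Rightarrow> 'a"
  assumes add: "\<And>x y. L (x + y) = L x + L y" and F: "F \<subseteq> range L"
  shows "card (L -` F) = card F * card {w. L w = 0}"
proof -
  have "L (inv_into UNIV L f) = f" if "f \<in> F" for f
    using F that by (auto intro: f_inv_into_f)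
  from sum_vimage[of L F "inv_into UNIV L" "\<lambda>_. 1 :: nat", OF add F this] show ?thesis
    by simp
qed

lemma add_subgroup_vimage:
  assumes "\<And>x y. L (x + y) = L x + L y" "add_subgroup F"
  shows "add_subgroup (L -` F)"
proof -
  have "L 0 = 0"
    using assms(1)[of 0 0] by simp
  then show ?thesis
    using assms by (auto simp: add_subgroup_def)
qed

text \<open>
  The preimage of a subgroup is a union of cosets of the kernel. For an additive polynomial $L$ with
  all roots in the field, the sum of inverses over a coset not containing 0 is the logarithmic
  derivative $L'/L$, whose numerator is the linear coefficient $c$ of $L$. Hence inverse sums transform
  affinely under preimages. The hypothesis \<open>coset\<close> is this property of $L$.
\<close>

lemma inv_sum_vimage:
  fixes L :: "'a \<Rightarrow> 'a"
  assumes add: "\<And>x y. L (x + y) = L x + L y" and F: "F \<subseteq> range L" "add_subgroup F"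
    and coset: "\<And>u. L u \<noteq> 0 \<Longrightarrow> (\<Sum>w\<in>{w. L w = 0}. inverse (u + w)) = c * inverse (L u)"
  shows "inv_sum (L -` F) = inv_sum {w. L w = 0} + c * inv_sum F"
proof -
  define W where "W = {w. L w = 0}"
  have L0: "L 0 = 0"
    using add[of 0 0] by simp
  have W: "add_subgroup W"
    by (simp add: W_def add_subgroup_def L0 add)
  define g where "g = inv_into UNIV L"
  have g: "L (g f) = f" if "f \<in> F" for f
    using F that by (auto simp: g_def intro: f_inv_into_f)
  have 0: "0 \<in> F"
    using F by (simp add: add_subgroup_def)
  have "inv_sum (L -` F) = (\<Sum>f\<in>F. \<Sum>w\<in>W. inverse (g f + w))"
    unfolding inv_sum_def W_def by (rule sum_vimage[OF add F(1) g])
  also have "\<dots> = (\<Sum>w\<in>W. inverse (g 0 + w)) + (\<Sum>f\<in>F - {0}. \<Sum>w\<in>W. inverse (g f + w))"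
    by (rule sum.remove) (auto simp: 0)
  also have "(\<Sum>w\<in>W. inverse (g 0 + w)) = inv_sum W"
    unfolding inv_sum_def by (rule sum_translate[OF W]) (simp add: W_def g 0)
  also have "(\<Sum>f\<in>F - {0}. \<Sum>w\<in>W. inverse (g f + w)) = (\<Sum>f\<in>F - {0}. c * inverse f)"
    by (intro sum.cong) (auto simp: W_def coset g)
  also have "\<dots> = c * inv_sum F"
    using sum.remove[of F 0 "\<lambda>f. c * inverse f"] 0 by (simp add: inv_sum_def sum_distrib_left)
  finally show ?thesis
    by (simp add: W_def)
qed

text \<open>
  The range has as many elements as the annihilator of a group of the size of the kernel, so one
  inclusion suffices. This identifies the range of a polynomial map without solving an equation.
\<close>

lemma range_eq_ann:
  fixes L :: "'a \<Rightarrow> 'a"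
  assumes add: "\<And>x y. L (x + y) = L x + L y" and P: "add_subgroup P" "card P = card {w. L w = 0}"
    and ort: "\<And>p x. p \<in> P \<Longrightarrow> Tr (p * L x) = 0"
  shows "range L = ann P"
proof -
  have "range L \<subseteq> ann P"
    using ort by (auto simp: ann_def mult.commute)
  moreover have "card (range L) = card (ann P)"
  proof -
    have "card (range L) * card P = CARD('a)"
      using card_vimage_additive[of L "range L", OF add] P(2) by (simp add: vimage_def)
    moreover have "card (ann P) * card P = CARD('a)"
      using card_ann[OF P(1)] by (simp add: mult.commute)
    ultimately show ?thesis
      by (metis mult_cancel2 mult_0_right zero_less_card_finite less_numeral_extra(3))
  qed
  ultimately show ?thesis
    by (intro card_subset_eq) auto
qed

text \<open>
  The preimage is taken under $x^2 + x/p$, whose kernel is $\{0, 1/p\}$ and whose range is the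
  hyperplane of all $f$ with \<open>Tr (p\<^sup>2 * f) = 0\<close>.
\<close>

lemma preimage_quadratic:
  assumes F: "add_subgroup F" and p: "p \<noteq> 0" "\<And>f. f \<in> F \<Longrightarrow> Tr (p\<^sup>2 * f) = 0"
  obtains E where "add_subgroup E" "card E = 2 * card F" "inv_sum E = p + inv_sum F / p"
proof
  define w where "w = inverse p"
  have w: "w \<noteq> 0" "p * w = 1"
    using p by (auto simp: w_def)
  define L where "L x = x\<^sup>2 + w * x" for x
  have add: "L (x + y) = L x + L y" for x y
    by (simp add: L_def square_add algebra_simps)
  have L_eq: "L x = x * (x + w)" for x
    by (simp add: L_def power2_eq_square algebra_simps)
  then have kernel: "{x. L x = 0} = {0, w}"
    by auto
  have "range L = ann {0, p\<^sup>2}"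
  proof (rule range_eq_ann[OF add])
    show "add_subgroup {0, p\<^sup>2}"
      by (auto simp: add_subgroup_def)
    show "card {0, p\<^sup>2} = card {x. L x = 0}"
      using p w by (simp add: kernel)
    have "Tr (p\<^sup>2 * L x) = 0" for x
    proof -
      have "p\<^sup>2 * L x = (p * x)\<^sup>2 + p * (p * w) * x"
        by (simp add: L_def power2_eq_square algebra_simps)
      then show ?thesis
        by (simp add: Tr_add w)
    qed
    then show "Tr (q * L x) = 0" if "q \<in> {0, p\<^sup>2}" for q x
      using that by auto
  qed
  then have range: "F \<subseteq> range L"
    using p by (auto simp: ann_def mult.commute)
  show "add_subgroup (L -` F)"
    by (rule add_subgroup_vimage[OF add F])
  show "card (L -` F) = 2 * card F"
    using card_vimage_additive[OF add range] w by (simp add: kernel)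
  have "inv_sum (L -` F) = inv_sum {x. L x = 0} + w * inv_sum F"
  proof (rule inv_sum_vimage[OF add range F])
    fix u assume "L u \<noteq> 0"
    then have "u \<noteq> 0" "u + w \<noteq> 0"
      by (auto simp: L_eq)
    then have "inverse u + inverse (u + w) = w * inverse (u * (u + w))"
      by (subst inverse_add) (simp_all add: mult_ac)
    then show "(\<Sum>x\<in>{x. L x = 0}. inverse (u + x)) = w * inverse (L u)"
      unfolding kernel using w by (simp add: L_eq)
  qed
  then show "inv_sum (L -` F) = p + inv_sum F / p"
    using w by (simp add: kernel inv_sum_def w_def field_simps)
qed

lemma scale_subgroup:
  assumes "add_subgroup F" "t \<noteq> 0"
  shows "add_subgroup ((*) t ` F)" "card ((*) t ` F) = card F" "inv_sum ((*) t ` F) = inv_sum F / t"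
proof -
  have inj: "inj_on ((*) t) F"
    using assms(2) by (auto simp: inj_on_def)
  show "add_subgroup ((*) t ` F)"
    using assms by (force simp: add_subgroup_def simp flip: distrib_left)
  show "card ((*) t ` F) = card F"
    by (rule card_image[OF inj])
  show "inv_sum ((*) t ` F) = inv_sum F / t"
    unfolding inv_sum_def sum.reindex[OF inj] sum_divide_distrib
    by (intro sum.cong) (simp_all add: divide_inverse mult.commute)
qed

text \<open>
  The set of parameters $p$ for which \<open>preimage_quadratic\<close> applies to $F$; squaring is additive, so
  it is again a subgroup.
\<close>

definition sqrt_ann :: "'a set \<Rightarrow> 'a set" where
  "sqrt_ann F = {x. x\<^sup>2 \<in> ann F}"

lemma add_subgroup_sqrt_ann: "add_subgroup (sqrt_ann F)"
  using add_subgroup_ann[of F] by (auto simp: add_subgroup_def sqrt_ann_def square_add)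

lemma card_sqrt_ann:
  assumes "add_subgroup F"
  shows "card F * card (sqrt_ann F) = CARD('a)"
proof -
  have "card (sqrt_ann F) = card (ann F)"
    unfolding sqrt_ann_def vimage_def[symmetric]
    by (rule card_vimage_inj) (use bij_square in \<open>auto simp: bij_def\<close>)
  then show ?thesis
    using card_ann[OF assms] by simp
qed

text \<open>
  Adding one dimension changes an inverse sum from 1 to $p + 1/p$. This is nonzero for $p \neq 1$, and
  such a $p$ is available as long as \<open>sqrt_ann F\<close> has more than two elements. Scaling then
  restores the value 1.
\<close>

lemma subgroup_inv_sum_1:
  assumes "1 \<le> m" "m < n"
  obtains F where "add_subgroup F" "card F = 2 ^ m" "inv_sum F = 1"
proof -
  have "\<exists>F. add_subgroup F \<and> card F = 2 ^ m \<and> inv_sum F = 1"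
    using assms
  proof (induction m rule: dec_induct)
    case base
    show ?case
      by (intro exI[of _ "{0, 1}"]) (auto simp: add_subgroup_def inv_sum_def)
  next
    case (step m)
    then obtain F where F: "add_subgroup F" "card F = 2 ^ m" "inv_sum F = 1"
      by auto
    have "card {0, 1::'a} < card (sqrt_ann F)"
    proof -
      have "2 ^ m * card (sqrt_ann F) = 2 ^ m * 2 ^ (n - m)"
        using card_sqrt_ann[OF F(1)] F(2) card_UNIV step by (simp flip: power_add)
      then have "card (sqrt_ann F) = 2 ^ (n - m)"
        by simp
      moreover have "(2::nat) ^ 1 < 2 ^ (n - m)"
        using step by (intro power_strict_increasing) auto
      ultimately show ?thesis
        by simp
    qed
    then have "\<not> sqrt_ann F \<subseteq> {0, 1}"
      by (meson card_mono finite not_le)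
    then obtain p where p: "p \<in> sqrt_ann F" "p \<noteq> 0" "p \<noteq> 1"
      by auto
    from preimage_quadratic[OF F(1) p(2)] p(1)
    obtain E where E: "add_subgroup E" "card E = 2 * card F" "inv_sum E = p + inv_sum F / p"
      by (auto simp: sqrt_ann_def ann_def)
    define t where "t = inv_sum E"
    have "p\<^sup>2 \<noteq> 1\<^sup>2"
      using p(3) by (subst square_eq_iff)
    then have "t \<noteq> 0"
      using p E(3) by (auto simp: t_def F(3) field_simps power2_eq_square)
    then show ?case
      using scale_subgroup[OF E(1), of t] E(2) F(2) by (intro exI[of _ "(*) t ` E"]) (auto simp: t_def)
  qed
  then show ?thesis
    using that by blast
qed

text \<open>
  Adding two dimensions at once can cancel the inverse sum. With $w_1 = cp$ and $w_2 = cr$, the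
  polynomial with kernel spanned by $w_1, w_2$ is $x^4 + bx^2 + c'x$, where
  $b = w_1^2 + w_1w_2 + w_2^2$ and $c' = w_1w_2(w_1+w_2)$. Its kernel has inverse sum $b/c'$, so the
  preimage of $F$ has inverse sum $b/c' + c'$. This vanishes when $b = c'^2$. Choosing $c$ so that
  $c' = c$, the condition becomes the equation of a conic, \<open>p\<^sup>2 + p * r + r\<^sup>2 = 1\<close>. Membership of
  $p$ and $r$ in \<open>sqrt_ann F\<close> says that $F$ lies in the range of the quartic.
\<close>

lemma preimage_quartic:
  assumes F: "add_subgroup F" "inv_sum F = 1"
    and pr: "p \<noteq> 0" "r \<noteq> 0" "p \<noteq> r" "p\<^sup>2 + p * r + r\<^sup>2 = 1" "p \<in> sqrt_ann F" "r \<in> sqrt_ann F"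
  obtains E where "add_subgroup E" "card E = 4 * card F" "inv_sum E = 0"
proof -
  obtain c where c: "c\<^sup>2 = inverse (p * r * (p + r))"
    by (rule square_root)
  have c0: "c \<noteq> 0"
    using c pr(1-3) by auto
  have c2: "c\<^sup>2 * (p * r * (p + r)) = 1"
    unfolding c using pr(1-3) by (intro left_inverse) simp
  \<comment> \<open>This says that \<open>c * s\<close> is a root of the quartic, divided by the nonzero factors.\<close>
  have rel: "c\<^sup>2 * s * (1 + s\<^sup>2) = 1" if "s \<in> {p, r, p + r}" for s
  proof -
    have "1 + p\<^sup>2 = r * (p + r)" "1 + r\<^sup>2 = p * (p + r)" "1 + (p + r)\<^sup>2 = p * r"
      unfolding pr(4)[symmetric] square_add by (simp_all add: power2_eq_square algebra_simps)
    then show ?thesis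
      using that c2 by (auto simp: mult_ac)
  qed
  define w1 w2 where "w1 = c * p" and "w2 = c * r"
  have w: "w1 \<noteq> 0" "w2 \<noteq> 0" "w1 \<noteq> w2"
    using c0 pr(1-3) by (auto simp: w1_def w2_def)
  have b: "w1\<^sup>2 + w1 * w2 + w2\<^sup>2 = c\<^sup>2"
  proof -
    have "w1\<^sup>2 + w1 * w2 + w2\<^sup>2 = c\<^sup>2 * (p\<^sup>2 + p * r + r\<^sup>2)"
      by (simp add: w1_def w2_def power2_eq_square algebra_simps)
    then show ?thesis
      by (simp add: pr(4))
  qed
  have w_prod: "w1 * w2 * (w1 + w2) = c"
  proof -
    have "w1 * w2 * (w1 + w2) = c * (c\<^sup>2 * (p * r * (p + r)))"
      by (simp add: w1_def w2_def power2_eq_square algebra_simps)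
    then show ?thesis
      by (simp add: c2)
  qed
  define L where "L x = x ^ 4 + c\<^sup>2 * x\<^sup>2 + c * x" for x
  have fourth: "x ^ 4 = (x\<^sup>2)\<^sup>2" for x :: 'a
    by simp
  have add: "L (x + y) = L x + L y" for x y
    unfolding L_def fourth square_add by (simp add: algebra_simps)
  have L_eq: "L x = (x * (x + w1)) * ((x + w2) * (x + w2 + w1))" for x
    unfolding L_def b[symmetric] by (subst w_prod[symmetric]) (simp add: eval_nat_numeral algebra_simps)
  have kernel: "{x. L x = 0} = {0, w1, w2, w1 + w2}"
    by (auto simp: L_eq add.commute)
  define P where "P = {0, p\<^sup>2, r\<^sup>2, (p + r)\<^sup>2}"
  have "range L = ann P"
  proof (rule range_eq_ann[OF add])
    show "add_subgroup P"
      by (auto simp: P_def add_subgroup_def square_add add_ac)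
    show "card P = card {x. L x = 0}"
      using pr w by (auto simp: P_def kernel square_add)
    have "Tr (s\<^sup>2 * L x) = 0" if "s \<in> {p, r, p + r}" for s x
    proof -
      have "s\<^sup>2 * L x = (s * x\<^sup>2)\<^sup>2 + (s\<^sup>2 * c\<^sup>2) * x\<^sup>2 + s\<^sup>2 * c * x"
        by (simp add: L_def eval_nat_numeral algebra_simps)
      \<comment> \<open>The trace is invariant under squaring: one square root and one square make all three terms multiples of \<open>x\<^sup>2\<close>.\<close>
      then have "Tr (s\<^sup>2 * L x) = Tr (s * x\<^sup>2) + Tr ((s\<^sup>2 * c\<^sup>2) * x\<^sup>2) + Tr ((s\<^sup>2 * c * x)\<^sup>2)"
        by (simp only: Tr_add Tr_square)
      also have "\<dots> = Tr (s * x\<^sup>2 + (s\<^sup>2 * c\<^sup>2) * x\<^sup>2 + (s\<^sup>2 * c * x)\<^sup>2)"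
        by (simp only: Tr_add)
      also have "s * x\<^sup>2 + (s\<^sup>2 * c\<^sup>2) * x\<^sup>2 + (s\<^sup>2 * c * x)\<^sup>2 = s * x\<^sup>2 * (1 + c\<^sup>2 * s * (1 + s\<^sup>2))"
        by (simp add: power2_eq_square algebra_simps)
      also have "\<dots> = 0"
        using rel[OF that] by simp
      finally show ?thesis
        by simp
    qed
    then show "Tr (q * L x) = 0" if "q \<in> P" for q x
      using that by (auto simp: P_def)
  qed
  moreover have "F \<subseteq> ann P"
    using pr(5,6) by (auto simp: P_def ann_def sqrt_ann_def mult.commute square_add distrib_left Tr_add)
  ultimately have range: "F \<subseteq> range L"
    by simp
  have "add_subgroup (L -` F)"
    by (rule add_subgroup_vimage[OF add F(1)])
  moreover have "card (L -` F) = 4 * card F"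
    using card_vimage_additive[OF add range] w by (simp add: kernel)
  moreover have "inv_sum (L -` F) = 0"
  proof -
    have "inv_sum (L -` F) = inv_sum {x. L x = 0} + c * inv_sum F"
    proof (rule inv_sum_vimage[OF add range F(1)])
      fix u assume u: "L u \<noteq> 0"
      define A B where "A = u * (u + w1)" and "B = (u + w2) * (u + w2 + w1)"
      have nz: "A \<noteq> 0" "B \<noteq> 0"
        using u by (auto simp: L_eq A_def B_def)
      have "inverse u + inverse (u + w1) = w1 * inverse A"
        using nz(1) by (subst inverse_add) (auto simp: A_def mult_ac)
      moreover have "inverse (u + w2) + inverse (u + w2 + w1) = w1 * inverse B"
        using nz(2) by (subst inverse_add) (auto simp: B_def mult_ac add_ac)
      ultimately have "(\<Sum>x\<in>{x. L x = 0}. inverse (u + x)) = w1 * (inverse A + inverse B)"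
        using w by (simp add: kernel distrib_left add_ac)
      also have "\<dots> = w1 * (A + B) * inverse (A * B)"
        using nz by (simp add: inverse_add mult_ac)
      also have "A + B = w2 * (w1 + w2)"
        by (simp add: A_def B_def algebra_simps)
      finally show "(\<Sum>x\<in>{x. L x = 0}. inverse (u + x)) = c * inverse (L u)"
        by (simp add: L_eq A_def B_def w_prod[symmetric] mult_ac)
    qed
    moreover have "inv_sum {x. L x = 0} = c"
    proof -
      have "inv_sum {x. L x = 0} = inverse w1 + inverse w2 + inverse (w1 + w2)"
        using w by (simp add: kernel inv_sum_def add_ac)
      also have "\<dots> = (w1\<^sup>2 + w1 * w2 + w2\<^sup>2) * inverse (w1 * w2 * (w1 + w2))"
        using w by (simp add: divide_simps) (simp add: power2_eq_square algebra_simps)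
      also have "\<dots> = c"
        unfolding b w_prod using c0 by (simp add: power2_eq_square)
      finally show ?thesis .
    qed
    ultimately show ?thesis
      by (simp add: F(2))
  qed
  ultimately show thesis
    by (rule that)
qed

section \<open>Character sums over a conic\<close>

definition conic :: "('a \<times> 'a) set" where
  "conic = {(a, b). a\<^sup>2 + a * b + b\<^sup>2 = 1}"

text \<open>
  Multiplication of $a + b\omega$ and $p + r\omega$ in the quadratic algebra with
  $\omega^2 = \omega + 1$. Its norm form is $a^2 + ab + b^2$, so the conic consists of the elements of
  norm 1 and is a group acting on the plane.
\<close>

definition quad_mult :: "'a \<times> 'a \<Rightarrow> 'a \<times> 'a \<Rightarrow> 'a \<times> 'a" where
  "quad_mult u v = (fst u * fst v + snd u * snd v, snd u * fst v + (fst u + snd u) * snd v)"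

lemma quad_mult_conic: "u \<in> conic \<Longrightarrow> v \<in> conic \<Longrightarrow> quad_mult u v \<in> conic"
proof -
  assume "u \<in> conic" "v \<in> conic"
  moreover obtain a b p r where uv: "u = (a, b)" "v = (p, r)"
    by fastforce
  moreover have "(a * p + b * r)\<^sup>2 + (a * p + b * r) * (b * p + (a + b) * r) + (b * p + (a + b) * r)\<^sup>2
      = (a\<^sup>2 + a * b + b\<^sup>2) * (p\<^sup>2 + p * r + r\<^sup>2)"
    by (simp add: power2_eq_square algebra_simps)
  ultimately show ?thesis
    by (simp add: conic_def quad_mult_def)
qed

text \<open>
  The determinant of multiplication by $d + e\omega$ is the norm of $d + e\omega$.
\<close>

lemma quad_mult_eq_0:
  assumes "quad_mult (d, e) (p, r) = (0, 0)" "(p, r) \<noteq> (0, 0)"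
  shows "d\<^sup>2 + d * e + e\<^sup>2 = 0"
proof -
  have 1: "d * p = e * r" and 2: "e * p = (d + e) * r"
    using assms(1) by (simp_all add: quad_mult_def)
  have "(d\<^sup>2 + d * e + e\<^sup>2) * p = (d + e) * (d * p) + e * (e * p)"
    by (simp add: power2_eq_square algebra_simps)
  also have "\<dots> = 0"
    unfolding 1 2 by (simp add: algebra_simps)
  finally have p: "(d\<^sup>2 + d * e + e\<^sup>2) * p = 0" .
  have "(d\<^sup>2 + d * e + e\<^sup>2) * r = d * ((d + e) * r) + e * (e * r)"
    by (simp add: power2_eq_square algebra_simps)
  also have "\<dots> = 0"
    unfolding 1[symmetric] 2[symmetric] by (simp add: algebra_simps)
  finally show ?thesis
    using p assms(2) by auto
qed

lemma conic_proportional: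
  assumes "(a, b) \<in> conic" "(a', b') \<in> conic" "a * b' = a' * b"
  shows "a = a'" "b = b'"
proof -
  have N: "a\<^sup>2 + a * b + b\<^sup>2 = 1" "a'\<^sup>2 + a' * b' + b'\<^sup>2 = 1"
    using assms by (auto simp: conic_def)
  have "a\<^sup>2 = a\<^sup>2 * (a'\<^sup>2 + a' * b' + b'\<^sup>2)"
    by (simp add: N)
  also have "\<dots> = a\<^sup>2 * a'\<^sup>2 + a' * a * (a * b') + (a * b')\<^sup>2"
    by (simp add: power2_eq_square algebra_simps)
  also have "\<dots> = a'\<^sup>2 * (a\<^sup>2 + a * b + b\<^sup>2)"
    unfolding assms(3) by (simp add: power2_eq_square algebra_simps)
  finally show "a = a'"
    by (simp add: N)
  have "b\<^sup>2 = b\<^sup>2 * (a'\<^sup>2 + a' * b' + b'\<^sup>2)"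
    by (simp add: N)
  also have "\<dots> = (a' * b)\<^sup>2 + b * b' * (a' * b) + b\<^sup>2 * b'\<^sup>2"
    by (simp add: power2_eq_square algebra_simps)
  also have "\<dots> = b'\<^sup>2 * (a\<^sup>2 + a * b + b\<^sup>2)"
    unfolding assms(3)[symmetric] by (simp add: power2_eq_square algebra_simps)
  finally show "b = b'"
    by (simp add: N)
qed

text \<open>
  The difference of two elements of norm 1 has norm $ab' + a'b$, which vanishes only if they are
  proportional, hence equal. So a difference of distinct elements is invertible, even when the
  algebra is not a field.
\<close>

lemma inj_quad_mult_left:
  assumes "v \<noteq> (0, 0)"
  shows "inj_on (\<lambda>u. quad_mult u v) conic"
proof (rule inj_onI)
  fix u u' assume u: "u \<in> conic" "u' \<in> conic" "quad_mult u v = quad_mult u' v"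
  obtain a b a' b' p r where eq: "u = (a, b)" "u' = (a', b')" "v = (p, r)"
    by (metis surj_pair)
  have "quad_mult (u + u') v = quad_mult u v + quad_mult u' v"
    by (simp add: quad_mult_def algebra_simps)
  then have "quad_mult (a + a', b + b') v = (0, 0)"
    unfolding u(3) by (simp add: eq prod_eq_iff)
  then have "(a + a')\<^sup>2 + (a + a') * (b + b') + (b + b')\<^sup>2 = 0"
    using assms unfolding eq by (rule quad_mult_eq_0)
  moreover have "(a + a')\<^sup>2 + (a + a') * (b + b') + (b + b')\<^sup>2
      = (a\<^sup>2 + a * b + b\<^sup>2) + (a'\<^sup>2 + a' * b' + b'\<^sup>2) + (a * b' + a' * b)"
    by (simp add: power2_eq_square algebra_simps)
  ultimately have "a * b' = a' * b"
    using u(1,2) by (simp add: eq conic_def)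
  then show "u = u'"
    using conic_proportional u(1,2) eq by blast
qed

lemma bij_quad_mult_right:
  assumes "u \<in> conic"
  shows "bij_betw (quad_mult u) conic conic"
proof -
  have "inj_on (quad_mult u) conic"
  proof (rule inj_onI)
    fix v v' assume v: "v \<in> conic" "v' \<in> conic" "quad_mult u v = quad_mult u v'"
    have comm: "quad_mult u v = quad_mult v u" for u v :: "'a \<times> 'a"
      by (simp add: quad_mult_def algebra_simps)
    have "u \<noteq> (0, 0)"
      using assms by (auto simp: conic_def)
    with v show "v = v'"
      using inj_quad_mult_left[of u] by (simp add: comm[of u] inj_on_def)
  qed
  moreover have "quad_mult u ` conic \<subseteq> conic"
    using assms quad_mult_conic by blast
  ultimately show ?thesis
    by (simp add: bij_betw_def endo_inj_surj)
qed

text \<open>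
  The Fourier coefficient of the indicator function of the conic at the character given by \<open>w\<close>.
\<close>

definition conic_sum :: "'a \<times> 'a \<Rightarrow> real" where
  "conic_sum w = (\<Sum>v\<in>conic. chi (fst w * fst v + snd w * snd v))"

text \<open>
  Multiplication by $u$ is self-adjoint for the standard bilinear form of the plane, so the symmetry of
  the conic passes unchanged to its Fourier coefficients.
\<close>

lemma conic_sum_quad_mult:
  assumes "u \<in> conic"
  shows "conic_sum (quad_mult u w) = conic_sum w"
proof -
  have "conic_sum w = (\<Sum>v\<in>conic. chi (fst w * fst (quad_mult u v) + snd w * snd (quad_mult u v)))"
    unfolding conic_sum_def by (rule sum.reindex_bij_betw[OF bij_quad_mult_right[OF assms], symmetric])
  also have "\<dots> = conic_sum (quad_mult u w)"
    unfolding conic_sum_def by (intro sum.cong refl arg_cong[of _ _ chi]) (simp add: quad_mult_def algebra_simps)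
  finally show ?thesis ..
qed

text \<open>
  The conic is a Sidon set up to the coincidences forced by characteristic 2. For $u = s + t$, the
  points $v$ with both $v$ and $u + v$ on the conic lie on a line in direction $u$ through $s$ and $t$,
  and a line meets the conic in at most two points.
\<close>

lemma conic_sidon:
  assumes "s \<in> conic" "t \<in> conic" "v \<in> conic" "s + t + v \<in> conic" "s \<noteq> t"
  shows "v = s \<or> v = t"
proof -
  obtain a b a' b' p r where eq: "s = (a, b)" "t = (a', b')" "v = (p, r)"
    by (metis surj_pair)
  define x y where "x = a + a'" and "y = b + b'"
  define N where "N = x\<^sup>2 + x * y + y\<^sup>2"
  have nz: "x \<noteq> 0 \<or> y \<noteq> 0"
    using assms(5) by (auto simp: x_def y_def eq)
  have N_ab: "a\<^sup>2 + a * b + b\<^sup>2 = 1" and N_pr: "p\<^sup>2 + p * r + r\<^sup>2 = 1"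
    using assms(1,3) by (simp_all add: conic_def eq)
  have "1 = (p + x)\<^sup>2 + (p + x) * (r + y) + (r + y)\<^sup>2"
    using assms(4) by (simp add: conic_def x_def y_def eq add_ac)
  also have "\<dots> = (p\<^sup>2 + p * r + r\<^sup>2) + N + (p * y + x * r)"
    by (simp add: N_def power2_eq_square algebra_simps)
  finally have 1: "N = p * y + x * r"
    unfolding N_pr by (simp add: add.assoc)
  have "1 = (a + x)\<^sup>2 + (a + x) * (b + y) + (b + y)\<^sup>2"
    using assms(2) by (simp add: conic_def x_def y_def eq)
  also have "\<dots> = (a\<^sup>2 + a * b + b\<^sup>2) + N + (a * y + x * b)"
    by (simp add: N_def power2_eq_square algebra_simps)
  finally have 2: "N = a * y + x * b"
    unfolding N_ab by (simp add: add.assoc)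
  \<comment> \<open>If the direction is isotropic, then $s$ is a multiple of it and would have norm 0 instead of 1.\<close>
  have N_nz: "N \<noteq> 0"
  proof
    assume N0: "N = 0"
    with 2 have *: "a * y = x * b"
      by simp
    have "x\<^sup>2 * (a\<^sup>2 + a * b + b\<^sup>2) = a\<^sup>2 * x\<^sup>2 + a * x * (x * b) + (x * b)\<^sup>2"
      by (simp add: power2_eq_square algebra_simps)
    also have "\<dots> = a\<^sup>2 * N"
      unfolding *[symmetric] N_def by (simp add: power2_eq_square algebra_simps)
    finally have "x = 0"
      by (simp add: N_ab N0)
    have "y\<^sup>2 * (a\<^sup>2 + a * b + b\<^sup>2) = (a * y)\<^sup>2 + (a * y) * b * y + b\<^sup>2 * y\<^sup>2"
      by (simp add: power2_eq_square algebra_simps)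
    also have "\<dots> = b\<^sup>2 * N"
      unfolding * N_def by (simp add: power2_eq_square algebra_simps)
    finally have "y = 0"
      by (simp add: N_ab N0)
    with \<open>x = 0\<close> nz show False
      by simp
  qed
  have "(p + a) * y + x * (r + b) = (p * y + x * r) + (a * y + x * b)"
    by (simp add: algebra_simps)
  also have "\<dots> = 0"
    unfolding 1[symmetric] 2[symmetric] by simp
  finally have par: "(p + a) * y = x * (r + b)"
    by simp
  obtain l where l: "p = a + l * x" "r = b + l * y"
  proof (cases "x = 0")
    case True
    with nz par show ?thesis
      by (intro that[of "(r + b) / y"]) (auto simp: add_ac)
  next
    case False
    with par have "(p + a) / x * y = r + b"
      by (simp add: field_simps)
    with False show ?thesis
      by (intro that[of "(p + a) / x"]) (auto simp: add_ac)
  qed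
  have "1 = (a\<^sup>2 + a * b + b\<^sup>2) + l\<^sup>2 * N + l * (a * y + x * b)"
    unfolding N_pr[symmetric] l N_def by (simp add: power2_eq_square algebra_simps)
  then have "l * (l + 1) * N = 0"
    unfolding 2[symmetric] N_ab by (simp add: power2_eq_square algebra_simps)
  then have "l = 0 \<or> l = 1"
    using N_nz by auto
  then show ?thesis
    using l by (auto simp: x_def y_def eq)
qed

lemma sum_prod_chi:
  "(\<Sum>w\<in>UNIV. chi (fst w * x + snd w * y)) = (if x = 0 \<and> y = 0 then real CARD('a) ^ 2 else 0)"
proof -
  have "(\<Sum>w\<in>UNIV. chi (fst w * x + snd w * y)) = (\<Sum>c\<in>UNIV. chi (x * c)) * (\<Sum>d\<in>UNIV. chi (y * d))"
    unfolding sum_product sum.cartesian_product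
    by (simp add: case_prod_beta chi_add mult.commute)
  then show ?thesis
    by (simp add: sum_chi_UNIV power2_eq_square)
qed

text \<open>
  By orthogonality the fourth moment counts quadruples of points of the conic with sum 0, and by
  the Sidon property these consist of two pairs of equal points.
\<close>

lemma sum_conic_sum_4: "(\<Sum>w\<in>UNIV. conic_sum w ^ 4) \<le> 3 * real CARD('a) ^ 2 * real (card conic) ^ 2"
proof -
  define e where "e w v = chi (fst w * fst v + snd w * snd v)" for w v :: "'a \<times> 'a"
  have e_add: "e w v * e w v' = e w (v + v')" for w v v'
    by (simp add: e_def chi_add[symmetric] algebra_simps)
  have e_sum: "(\<Sum>w\<in>UNIV. e w v) = (if v = 0 then real CARD('a) ^ 2 else 0)" for v
    by (cases v) (simp add: e_def sum_prod_chi zero_prod_def)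
  define S where "S s v = {x \<in> conic. s + v + x \<in> conic}" for s v :: "'a \<times> 'a"
  have card_S: "(\<Sum>v\<in>conic. card (S s v)) \<le> 3 * card conic" if "s \<in> conic" for s
  proof -
    have "card (S s v) \<le> 2" if "v \<in> conic - {s}" for v
    proof -
      have "S s v \<subseteq> {s, v}"
        unfolding S_def using conic_sidon[of s v] that \<open>s \<in> conic\<close> by blast
      then have "card (S s v) \<le> card {s, v}"
        by (intro card_mono) auto
      then show ?thesis
        by (simp add: card_insert_if split: if_splits)
    qed
    then have "(\<Sum>v\<in>conic - {s}. card (S s v)) \<le> (\<Sum>v\<in>conic - {s}. 2)"
      by (rule sum_mono)
    moreover have "card (S s s) \<le> card conic"
      by (intro card_mono) (auto simp: S_def)
    ultimately have "(\<Sum>v\<in>conic. card (S s v)) \<le> card conic + (\<Sum>v\<in>conic - {s}. 2)"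
      using that by (subst sum.remove[of conic s]) (auto intro!: add_mono)
    also have "\<dots> \<le> 3 * card conic"
      using card_mono[of conic "conic - {s}"] by auto
    finally show ?thesis .
  qed
  have 4: "conic_sum w ^ 4 = (\<Sum>s\<in>conic. \<Sum>v\<in>conic. \<Sum>x\<in>conic. \<Sum>y\<in>conic. e w (s + v + x + y))" for w
  proof -
    have "conic_sum w ^ 4 = conic_sum w * conic_sum w * conic_sum w * conic_sum w"
      by (simp add: eval_nat_numeral)
    moreover have "conic_sum w = (\<Sum>v\<in>conic. e w v)"
      by (simp add: conic_sum_def e_def)
    ultimately show ?thesis
      by (simp only: sum_distrib_left sum_distrib_right e_add add_ac)
  qed
  have "(\<Sum>w\<in>UNIV. conic_sum w ^ 4) = (\<Sum>s\<in>conic. \<Sum>v\<in>conic. \<Sum>x\<in>conic. \<Sum>y\<in>conic. \<Sum>w\<in>UNIV.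
      e w (s + v + x + y))"
    unfolding 4 by (simp only: sum.swap[of _ conic UNIV])
  also have "\<dots> = (\<Sum>s\<in>conic. \<Sum>v\<in>conic. \<Sum>x\<in>conic. \<Sum>y\<in>conic.
      if y = s + v + x then real CARD('a) ^ 2 else 0)"
    unfolding e_sum by (intro sum.cong refl if_cong) (auto simp: prod_eq_iff)
  also have "\<dots> = (\<Sum>s\<in>conic. \<Sum>v\<in>conic. real CARD('a) ^ 2 * real (card (S s v)))"
    by (intro sum.cong refl) (simp add: S_def sum.If_cases Int_def mult.commute)
  also have "\<dots> = real CARD('a) ^ 2 * (\<Sum>s\<in>conic. real (\<Sum>v\<in>conic. card (S s v)))"
    by (simp add: sum_distrib_left)
  also have "\<dots> \<le> real CARD('a) ^ 2 * (\<Sum>s\<in>conic. real (3 * card conic))"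
    by (intro mult_left_mono sum_mono of_nat_mono card_S) auto
  also have "\<dots> = 3 * real CARD('a) ^ 2 * real (card conic) ^ 2"
    by (simp add: power2_eq_square)
  finally show ?thesis .
qed

text \<open>
  A nonzero frequency has an orbit of as many points as the conic under multiplication, and the
  coefficient is constant on it. So a single coefficient has at most its share of the fourth moment.
  With $q$ elements in the field this gives size $O(q^{3/4})$: weaker than the square-root bound of
  Weil, but elementary.
\<close>

lemma conic_sum_bound:
  assumes "w \<noteq> (0, 0)"
  shows "conic_sum w ^ 4 \<le> 3 * real CARD('a) ^ 2 * real (card conic)"
proof -
  have "real (card conic) * conic_sum w ^ 4 = (\<Sum>u\<in>conic. conic_sum (quad_mult u w) ^ 4)"
    by (simp add: conic_sum_quad_mult)
  also have "\<dots> = (\<Sum>v\<in>(\<lambda>u. quad_mult u w) ` conic. conic_sum v ^ 4)"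
    by (simp add: sum.reindex[OF inj_quad_mult_left[OF assms]])
  also have "\<dots> \<le> (\<Sum>v\<in>UNIV. conic_sum v ^ 4)"
    by (intro sum_mono2) auto
  also have "\<dots> \<le> 3 * real CARD('a) ^ 2 * real (card conic) ^ 2"
    by (rule sum_conic_sum_4)
  finally have "real (card conic) * conic_sum w ^ 4 \<le> real (card conic) * (3 * real CARD('a) ^ 2 * real (card conic))"
    by (simp add: power2_eq_square mult_ac)
  moreover have "(1, 0) \<in> conic"
    by (simp add: conic_def)
  then have "real (card conic) > 0"
    by (metis card_gt_0_iff empty_iff finite of_nat_0_less_iff)
  ultimately show ?thesis
    by (simp only: mult_le_cancel_left_pos)
qed

text \<open>
  The line through the point $(1, 0)$ in direction $(t, 1)$ meets the conic in one further point,
  unless \<open>t\<^sup>2 + t + 1 = 0\<close>.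
\<close>

lemma card_conic: "CARD('a) \<le> card conic + 2"
proof -
  define N where "N t = t\<^sup>2 + t + 1" for t :: 'a
  define g where "g t = (1 + t / N t, 1 / N t)" for t
  have "card {t. N t = 0} \<le> 2"
  proof (cases "\<exists>s. N s = 0")
    case True
    then obtain s where s: "N s = 0" ..
    have "t \<in> {s, s + 1}" if "N t = 0" for t
    proof -
      have "(t + s) * (t + s + 1) = N t + N s"
        by (simp add: N_def power2_eq_square algebra_simps)
      then have "(t + s) * (t + s + 1) = 0"
        using s that by simp
      then show ?thesis
        by (auto simp: add.assoc)
    qed
    then have "card {t. N t = 0} \<le> card {s, s + 1}"
      by (intro card_mono) auto
    then show ?thesis
      by (simp add: card_insert_if split: if_splits)
  qed simp
  moreover have "CARD('a) = card {t. N t = 0} + card {t. N t \<noteq> 0}"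
    using card_Un_disjoint[of "{t. N t = 0}" "{t. N t \<noteq> 0}"]
    by (simp add: Collect_disj_eq[symmetric] disjoint_iff)
  moreover have "card {t. N t \<noteq> 0} \<le> card conic"
  proof (rule card_inj_on_le)
    show "inj_on g {t. N t \<noteq> 0}"
    proof (rule inj_onI)
      fix s t assume st: "s \<in> {t. N t \<noteq> 0}" "t \<in> {t. N t \<noteq> 0}" "g s = g t"
      then have "N s = N t" "s / N s = t / N t"
        by (auto simp: g_def)
      then show "s = t"
        using st by simp
    qed
    show "g ` {t. N t \<noteq> 0} \<subseteq> conic"
    proof (rule image_subsetI)
      fix t assume "t \<in> {t. N t \<noteq> 0}"
      then have t: "N t \<noteq> 0"
        by simp
      define l where "l = 1 / N t"
      have "(1 + t * l)\<^sup>2 + (1 + t * l) * l + l\<^sup>2 = 1 + l * (1 + l * N t)"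
        by (simp add: N_def power2_eq_square algebra_simps)
      also have "\<dots> = 1"
        using t by (simp add: l_def)
      finally show "g t \<in> conic"
        by (simp add: g_def conic_def l_def)
    qed
  qed simp
  ultimately show ?thesis
    by linarith
qed

section \<open>Subspaces on which the inverses sum to zero\<close>

lemma sum_conic_sum_ann:
  assumes K: "add_subgroup K"
  shows "(\<Sum>w\<in>ann K \<times> ann K. conic_sum w) = real (card (ann K)) ^ 2 * real (card (conic \<inter> K \<times> K))"
proof -
  have "(\<Sum>w\<in>ann K \<times> ann K. conic_sum w)
      = (\<Sum>v\<in>conic. \<Sum>w\<in>ann K \<times> ann K. chi (fst v * fst w) * chi (snd v * snd w))"
    unfolding conic_sum_def by (subst sum.swap) (simp add: chi_add mult.commute)
  also have "\<dots> = (\<Sum>v\<in>conic. (\<Sum>c\<in>ann K. chi (fst v * c)) * (\<Sum>d\<in>ann K. chi (snd v * d)))"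
    unfolding sum_product sum.cartesian_product by (simp add: case_prod_beta)
  also have "\<dots> = (\<Sum>v\<in>conic. if v \<in> K \<times> K then real (card (ann K)) ^ 2 else 0)"
    by (intro sum.cong) (auto simp: sum_chi[OF add_subgroup_ann] ann_ann[OF K] power2_eq_square)
  also have "\<dots> = real (card (ann K)) ^ 2 * real (card (conic \<inter> K \<times> K))"
    by (simp add: sum.If_cases mult.commute)
  finally show ?thesis .
qed

text \<open>
  Expand the indicator function of $K \times K$ in characters. The trivial character contributes the
  size $c$ of the conic, and there are at most $M$ others, where $M$ is the index of $K \times K$ in
  the plane. Since $q \geq 64 M^4$, the fourth-moment bound keeps each of them above $-c/(2M)$, so at
  least half of the main term survives.
\<close>

lemma conic_inter_subgroup:
  assumes K: "add_subgroup K" and large: "64 * card (ann K) ^ 8 \<le> CARD('a)"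
  shows "3 < card (conic \<inter> K \<times> K)"
proof -
  define q where "q = real CARD('a)"
  define c where "c = real (card conic)"
  define M where "M = real (card (ann K)) ^ 2"
  define N where "N = real (card (conic \<inter> K \<times> K))"
  have "0 \<in> ann K"
    using add_subgroup_ann[of K] by (simp add: add_subgroup_def)
  then have "card (ann K) > 0"
    by (auto simp: card_gt_0_iff)
  then have M: "M \<ge> 1"
    by (simp add: M_def)
  have "q \<ge> real (64 * card (ann K) ^ 8)"
    using large unfolding q_def by (simp only: of_nat_le_iff)
  then have qM: "64 * M ^ 4 \<le> q"
    by (simp add: M_def flip: power_mult)
  have M4: "M \<le> M ^ 4"
    using power_increasing[of 1 4 M] M by simp
  have "q \<ge> 64"
    using qM M M4 by linarith
  moreover have "q \<le> c + 2"
    using card_conic unfolding q_def c_def by linarith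
  \<comment> \<open>The loss of 2 is at most a fraction 1/32 of \<open>q\<close>, and $(31/32)^3 > 3/4$ gives room below.\<close>
  ultimately have c: "31 / 32 * q \<le> c" "c > 0"
    by simp_all
  have lower: "- c / (2 * M) \<le> conic_sum w" if w: "w \<noteq> (0, 0)" for w
  proof (rule ccontr)
    assume "\<not> ?thesis"
    then have "c / (2 * M) \<le> - conic_sum w"
      by simp
    then have "(c / (2 * M)) ^ 4 \<le> (- conic_sum w) ^ 4"
      using c M by (intro power_mono) auto
    also have "\<dots> \<le> 3 * q ^ 2 * c"
      using conic_sum_bound[OF w] by (simp add: q_def c_def)
    finally have "c ^ 4 \<le> 48 * q ^ 2 * c * M ^ 4"
      using M by (simp add: power_divide power_mult_distrib field_simps)
    then have "c * c ^ 3 \<le> c * (48 * q ^ 2 * M ^ 4)"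
      by (simp add: eval_nat_numeral mult_ac)
    then have "c ^ 3 \<le> 48 * q ^ 2 * M ^ 4"
      using c(2) by (simp only: mult_le_cancel_left_pos)
    also have "\<dots> = 3 / 4 * q ^ 2 * (64 * M ^ 4)"
      by simp
    also have "\<dots> \<le> 3 / 4 * q ^ 2 * q"
      by (intro mult_left_mono qM) auto
    also have "\<dots> = 3 / 4 * q ^ 3"
      by (simp add: eval_nat_numeral)
    finally have "c ^ 3 \<le> 3 / 4 * q ^ 3" .
    moreover have "(31 / 32 * q) ^ 3 \<le> c ^ 3"
      using c(1) \<open>q \<ge> 64\<close> by (intro power_mono) auto
    moreover have "q ^ 3 > 0"
      using \<open>q \<ge> 64\<close> by simp
    ultimately show False
      by (simp add: power_mult_distrib power_divide)
  qed
  have "c / 2 = c + M * (- c / (2 * M))"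
    using M by (simp add: field_simps)
  also have "\<dots> \<le> c + (\<Sum>w\<in>ann K \<times> ann K - {(0, 0)}. - c / (2 * M))"
  proof -
    have "card (ann K \<times> ann K - {(0, 0)}) \<le> card (ann K \<times> ann K)"
      by (intro card_mono) auto
    then have "real (card (ann K \<times> ann K - {(0, 0)})) \<le> M"
      by (simp add: M_def card_cartesian_product power2_eq_square flip: of_nat_mult)
    then have "real (card (ann K \<times> ann K - {(0, 0)})) * (c / (2 * M)) \<le> M * (c / (2 * M))"
      using c M by (intro mult_right_mono) auto
    then show ?thesis
      by simp
  qed
  also have "\<dots> \<le> conic_sum (0, 0) + (\<Sum>w\<in>ann K \<times> ann K - {(0, 0)}. conic_sum w)"
    by (intro add_mono sum_mono lower) (auto simp: conic_sum_def c_def)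
  also have "\<dots> = (\<Sum>w\<in>ann K \<times> ann K. conic_sum w)"
    using \<open>0 \<in> ann K\<close> by (subst sum.remove[of _ "(0, 0)"]) auto
  also have "\<dots> = M * N"
    unfolding M_def N_def by (rule sum_conic_sum_ann[OF K])
  finally have "c / 2 \<le> M * N" .
  moreover have "31 * M \<le> c / 2"
    using c qM M4 by linarith
  ultimately have "M * 31 \<le> M * N"
    by simp
  then have "31 \<le> N"
    using M by simp
  then show ?thesis
    by (simp add: N_def)
qed

text \<open>
  The pair needed for \<open>preimage_quartic\<close> must be linearly independent. Only three points of the conic
  are not, namely $(0,1)$, $(1,0)$ and $(1,1)$, and so a fourth point in the subgroup is enough.
\<close>

lemma subgroup_inv_sum_0:
  assumes "1 \<le> m" "8 * m + 6 \<le> n"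
  obtains E where "add_subgroup E" "card E = 2 ^ (m + 2)" "inv_sum E = 0"
proof -
  obtain F where F: "add_subgroup F" "card F = 2 ^ m" "inv_sum F = 1"
    using subgroup_inv_sum_1[of m] assms by auto
  define K where "K = sqrt_ann F"
  have K: "add_subgroup K"
    unfolding K_def by (rule add_subgroup_sqrt_ann)
  have FK: "card K * card F = card K * card (ann K)"
    using card_sqrt_ann[OF F(1)] card_ann[OF K] by (simp add: K_def mult.commute)
  have "card K \<noteq> 0"
    using K by (auto simp: add_subgroup_def)
  with FK have card_ann_K: "card (ann K) = 2 ^ m"
    by (simp add: F(2))
  have "64 * card (ann K) ^ 8 = 2 ^ (8 * m + 6)"
    by (simp add: card_ann_K power_add mult.commute flip: power_mult)
  also have "\<dots> \<le> CARD('a)"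
    unfolding card_UNIV using assms by (intro power_increasing) auto
  finally have "3 < card (conic \<inter> K \<times> K)"
    by (rule conic_inter_subgroup[OF K])
  then have "\<not> conic \<inter> K \<times> K \<subseteq> {(0, 1), (1, 0), (1, 1)}"
    using card_mono[of "{(0, 1), (1, 0), (1, 1)}" "conic \<inter> K \<times> K"] by auto
  then obtain p r where pr: "(p, r) \<in> conic" "p \<in> K" "r \<in> K" "(p, r) \<notin> {(0, 1), (1, 0), (1, 1)}"
    by auto
  have N: "p\<^sup>2 + p * r + r\<^sup>2 = 1"
    using pr(1) by (simp add: conic_def)
  have one: "x = 1" if "x\<^sup>2 = 1" for x :: 'a
    using that square_eq_iff[of x 1] by simp
  have "p \<noteq> 0"
    using N pr(4) one[of r] by auto
  moreover have "r \<noteq> 0"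
    using N pr(4) one[of p] by auto
  moreover have "p \<noteq> r"
    using N pr(4) one[of p] by (auto simp: power2_eq_square)
  ultimately obtain E where "add_subgroup E" "card E = 4 * card F" "inv_sum E = 0"
    using preimage_quartic[OF F(1,3) _ _ _ N] pr(2,3) unfolding K_def by metis
  then show thesis
    by (intro that[of E]) (simp_all add: F(2) power_add)
qed

text \<open>
  A subspace with a basis of $d$ elements has $2^d$ elements, so the dimension can be read off from
  the cardinality.
\<close>

lemma F2_affine_subspace_subgroup:
  assumes E: "add_subgroup E" "card E = 2 ^ k"
  shows "F2_affine_subspace k E"
proof -
  interpret V: vector_space "F2_scale :: bit \<Rightarrow> 'a \<Rightarrow> 'a"
    by (rule vector_space_F2_scale) (rule card_UNIV)
  have sub: "V.subspace E"
    using E(1) by (auto simp: V.subspace_def add_subgroup_def F2_scale_def)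
  have card_span: "card (V.span B) = 2 ^ card B" if "V.independent B" for B
  proof -
    have "finite B"
      by simp
    then show ?thesis
      using that
    proof (induction B)
      case (insert b B)
      then have b: "b \<notin> V.span B" and indep: "V.independent B"
        by (simp_all add: V.independent_insert)
      have "V.span (insert b B) = V.span B \<union> (\<lambda>x. b + x) ` V.span B"
      proof (intro subset_antisym subsetI)
        fix x assume "x \<in> V.span (insert b B)"
        then obtain k where "x + F2_scale k b \<in> V.span B"
          by (auto simp: V.span_insert)
        then show "x \<in> V.span B \<union> (\<lambda>x. b + x) ` V.span B"
          by (cases k) (auto simp: F2_scale_def image_iff add_ac intro!: bexI[of _ "b + x"])
      next
        fix x assume "x \<in> V.span B \<union> (\<lambda>x. b + x) ` V.span B"
        then have "x + F2_scale 0 b \<in> V.span B \<or> x + F2_scale 1 b \<in> V.span B"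
          by (auto simp: F2_scale_def add_ac)
        then have "\<exists>k. x + F2_scale k b \<in> V.span B"
          by blast
        then show "x \<in> V.span (insert b B)"
          by (simp add: V.span_insert)
      qed
      moreover have "V.span B \<inter> (\<lambda>x. b + x) ` V.span B = {}"
      proof -
        have "b + x \<notin> V.span B" if "x \<in> V.span B" for x
          using V.span_add_eq2[OF that, of b] b by simp
        then show ?thesis
          by auto
      qed
      ultimately show ?case
        using insert indep by (simp add: card_Un_disjoint card_image inj_on_def)
    qed simp
  qed
  obtain B where B: "B \<subseteq> E" "V.independent B" "E \<subseteq> V.span B" "card B = V.dim E"
    by (rule V.basis_exists)
  have "V.span B = E"
    using B sub by (meson V.span_minimal subset_antisym)
  then have "(2::nat) ^ k = 2 ^ V.dim E"
    using card_span[OF B(2)] B(4) E(2) by simp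
  then have "V.dim E = k"
    by simp
  then show ?thesis
    unfolding F2_affine_subspace_def using sub by (intro exI[of _ 0] exI[of _ E]) auto
qed

end

section \<open>The numerical condition\<close>

text \<open>
  It suffices that $13 \log_2(1 + \sqrt{21}) \leq 3 \cdot 10.8$, because $10.8 \cdot 19/13 > 15.7$. The fraction $72/29$ lies between
  $\log_2(1 + \sqrt{21}) \approx 2.4809$ and $32.4/13 \approx 2.4923$, which turns the estimate into
  one between integer powers.
\<close>

lemma log_condition:
  fixes k n :: nat
  assumes "k \<ge> 3" "real n \<ge> 10.8 * real k - 15.7"
  shows "real n \<ge> log 2 (1 + sqrt 21) / 3 * (13 * real k - 19)"
proof -
  have "sqrt 21 \<le> 4.583"
    by (rule real_le_lsqrt) (simp_all add: power2_eq_square)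
  then have "(1 + sqrt 21) ^ 29 \<le> (5.583::real) ^ 29"
    by (intro power_mono) auto
  also have "\<dots> \<le> 2 ^ 72"
    by (simp add: divide_simps)
  finally have "log 2 ((1 + sqrt 21) ^ 29) \<le> log 2 (2 ^ 72)"
    by (intro log_mono) (auto intro!: zero_less_power add_pos_nonneg)
  moreover have "log 2 (2 ^ 72 :: real) = 72"
    by (subst log_nat_power) auto
  moreover have "log 2 ((1 + sqrt 21) ^ 29) = 29 * log 2 (1 + sqrt 21)"
    by (subst log_nat_power) (auto intro: add_pos_nonneg)
  ultimately have "log 2 (1 + sqrt 21) / 3 \<le> 10.8 / 13"
    by simp
  then have "log 2 (1 + sqrt 21) / 3 * (13 * real k - 19) \<le> 10.8 / 13 * (13 * real k - 19)"
    using assms(1) by (intro mult_right_mono) auto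
  then show ?thesis
    using assms(2) by (simp add: field_simps)
qed

text \<open>
  The crude bound $\log_2(1 + \sqrt{21}) \geq 2$ is enough.
\<close>

lemma log_condition_imp_linear:
  fixes k n :: nat
  assumes "k \<ge> 3" "real n \<ge> log 2 (1 + sqrt 21) / 3 * (13 * real k - 19)"
  shows "n + 10 \<ge> 8 * k"
proof -
  have "3 \<le> sqrt 21"
    by (rule real_le_rsqrt) simp
  then have "log 2 (2 ^ 2) \<le> log 2 (1 + sqrt 21)"
    by (intro log_mono) auto
  then have "2 \<le> log 2 (1 + sqrt 21)"
    by (subst (asm) log_nat_power) auto
  then have "2 / 3 * (13 * real k - 19) \<le> log 2 (1 + sqrt 21) / 3 * (13 * real k - 19)"
    using assms(1) by (intro mult_right_mono) auto
  also have "\<dots> \<le> real n"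
    by (rule assms)
  finally have "real (26 * k) \<le> real (3 * n + 38)"
    by (simp add: field_simps)
  then have "26 * k \<le> 3 * n + 38"
    by linarith
  then show ?thesis
    using assms(1) by presburger
qed

theorem theorem5p1:
  fixes k n :: nat
  assumes "k \<ge> 3"
  shows "(CARD('a::{field,finite}) = 2 ^ n \<longrightarrow>
            real n \<ge> log 2 (1 + sqrt 21) / 3 * (13 * real k - 19) \<longrightarrow>
            \<not> sum_free_of_order k (f_inv :: 'a \<Rightarrow> 'a))
         \<and> (real n \<ge> 10.8 * real k - 15.7 \<longrightarrow>
            real n \<ge> log 2 (1 + sqrt 21) / 3 * (13 * real k - 19))"
proof (intro conjI impI)
  assume card: "CARD('a) = 2 ^ n"
  assume "real n \<ge> log 2 (1 + sqrt 21) / 3 * (13 * real k - 19)"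
  with assms have "n + 10 \<ge> 8 * k"
    by (rule log_condition_imp_linear)
  interpret binary_field n "TYPE('a)"
    by unfold_locales (rule card)
  have "1 \<le> k - 2" "8 * (k - 2) + 6 \<le> n"
    using assms \<open>n + 10 \<ge> 8 * k\<close> by simp_all
  then obtain E :: "'a set" where E: "add_subgroup E" "card E = 2 ^ (k - 2 + 2)" "inv_sum E = 0"
    by (rule subgroup_inv_sum_0)
  have "F2_affine_subspace k E"
    using E(1,2) assms by (intro F2_affine_subspace_subgroup) (simp_all flip: add_2_eq_Suc')
  moreover have "f_inv = (inverse :: 'a \<Rightarrow> 'a)"
    by (auto simp: f_inv_def)
  ultimately show "\<not> sum_free_of_order k (f_inv :: 'a \<Rightarrow> 'a)"
    using E(3) by (auto simp: sum_free_of_order_def inv_sum_def)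
qed (rule log_condition[OF assms])

end
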